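(* Let $\delta\in\left(0,\tfrac34-\tfrac{\sqrt5}{4}\right]$ and $x=\frac{2-2\delta}{3-2\delta}$. Then no deterministic online algorithm for the Online Simple Knapsack problem with removability and item size estimates with additive accuracy $\delta$ has competitive ratio smaller than $\frac1x$.
   Context: Online Simple Knapsack with Removability and Item Size Estimates (additive accuracy $\delta\ge0$): an instance consists of actual sizes $x_1,\dots,x_n\in[0,1]$ and estimates $x_1',\dots,x_n'$ with $x_i'-\delta\le x_i\le x_i'+\delta$. A deterministic online algorithm knows $\delta$ and all estimates from the start; actual sizes are revealed one at a time. When $x_i$ is revealed, the algorithm may first permanently discard any subset of the items currently in its knapsack (capacity $1$; discarded items can never be packed again), and then either pack $x_i$ (only if the current total plus $x_i$ is at most $1$) or reject it permanently. The gain is the total size in the knapsack at the end; $\mathrm{OPT}$ is the maximum total size of a subset of the actual items with sum at most $1$; the competitive ratio is the supremum of $\mathrm{OPT}/\mathrm{gain}$ over all instances with accuracy $\delta$. *)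

theory Defs
  imports Complex_Main "HOL-Library.Extended_Nonnegative_Real"
begin

text \<open>Items are numbered from 0, so item \<open>i\<close> has actual size \<open>xs ! i\<close> and estimate \<open>es ! i\<close>.\<close>

definition knapsack_instance :: "real \<Rightarrow> real list \<Rightarrow> real list \<Rightarrow> bool" where
  "knapsack_instance \<delta> es xs \<longleftrightarrow>
     length es = length xs \<and>
     (\<forall>i<length xs. 0 \<le> xs ! i \<and> xs ! i \<le> 1 \<and> es ! i - \<delta> \<le> xs ! i \<and> xs ! i \<le> es ! i + \<delta>)"

definition total_size :: "real list \<Rightarrow> nat set \<Rightarrow> real" where
  "total_size xs S = (\<Sum>i\<in>S. xs ! i)"

text \<open>A strategy maps the accuracy, all estimates, and the actual sizes revealed so far (the
  current item being the last one) to the set of packed items to be discarded now and the decision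
  whether to pack the current item. Its own earlier decisions are a function of these
  arguments, so they need not be passed.\<close>

type_synonym strategy = "real \<Rightarrow> real list \<Rightarrow> real list \<Rightarrow> nat set \<times> bool"

definition discards :: "strategy \<Rightarrow> real \<Rightarrow> real list \<Rightarrow> real list \<Rightarrow> nat \<Rightarrow> nat set" where
  "discards A \<delta> es xs i = fst (A \<delta> es (take (Suc i) xs))"

definition packs :: "strategy \<Rightarrow> real \<Rightarrow> real list \<Rightarrow> real list \<Rightarrow> nat \<Rightarrow> bool" where
  "packs A \<delta> es xs i \<longleftrightarrow> snd (A \<delta> es (take (Suc i) xs))"

text \<open>The knapsack content before item \<open>i\<close> is revealed, i.e. after items \<open>0, ..., i - 1\<close>.\<close>

primrec content :: "strategy \<Rightarrow> real \<Rightarrow> real list \<Rightarrow> real list \<Rightarrow> nat \<Rightarrow> nat set" where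
  "content A \<delta> es xs 0 = {}"
| "content A \<delta> es xs (Suc i) =
     (content A \<delta> es xs i - discards A \<delta> es xs i) \<union> (if packs A \<delta> es xs i then {i} else {})"

definition online_algorithm :: "real \<Rightarrow> strategy \<Rightarrow> bool" where
  "online_algorithm \<delta> A \<longleftrightarrow>
     (\<forall>es xs. knapsack_instance \<delta> es xs \<longrightarrow>
       (\<forall>i<length xs.
          discards A \<delta> es xs i \<subseteq> content A \<delta> es xs i \<and>
          (packs A \<delta> es xs i \<longrightarrow>
             total_size xs (content A \<delta> es xs i - discards A \<delta> es xs i) + xs ! i \<le> 1)))"

definition gain :: "strategy \<Rightarrow> real \<Rightarrow> real list \<Rightarrow> real list \<Rightarrow> real" where
  "gain A \<delta> es xs = total_size xs (content A \<delta> es xs (length xs))"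

definition OPT :: "real list \<Rightarrow> real" where
  "OPT xs = Max {total_size xs S | S. S \<subseteq> {..<length xs} \<and> total_size xs S \<le> 1}"

text \<open>In \<^typ>\<open>ennreal\<close>, \<open>a / 0\<close> is \<open>\<infinity>\<close> for \<open>a > 0\<close>, while \<open>0 / 0 = 0\<close>, so that
  instances with optimum 0 do not contribute to the supremum.\<close>

definition competitive_ratio :: "real \<Rightarrow> strategy \<Rightarrow> ennreal" where
  "competitive_ratio \<delta> A =
     (SUP (es, xs) \<in> {(es, xs). knapsack_instance \<delta> es xs}.
        ennreal (OPT xs) / ennreal (gain A \<delta> es xs))"

end

theory Submission imports Defs begin

text \<open>
  Put \<open>s = 1 - x\<close>, so that \<open>2 * (s - \<delta>) = x * (1 - 2 * \<delta>)\<close>. Up to an arbitrarily small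
  perturbation, the adversary announces items of sizes \<open>s, x, x, s - \<delta>\<close>, and the first two do
  not fit together. If the algorithm gives up the first, the third completes it to 1 and the
  last one fits nowhere else. If it gives up the second, then the third comes slightly larger than
  the second. Should the algorithm switch to the third, the last item completes the second to
  1 and does not fit with the third; otherwise the last item has its smallest possible size
  \<open>s - 2 * \<delta>\<close>, and the algorithm ends with at most \<open>2 * s - 2 * \<delta>\<close> against the
  optimum \<open>x + s - 2 * \<delta> = 1 - 2 * \<delta>\<close>.
\<close>

text \<open>The strategy sees only the sizes revealed so far. This lets the adversary choose later
  sizes in response to earlier decisions.\<close>

lemma content_cong_take:
  assumes "take m xs = take m ys"
  shows "content A \<delta> es xs m = content A \<delta> es ys m"
  using assms
proof (induction m)
  case (Suc m)
  have "take m xs = take m ys"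
    using arg_cong[OF Suc.prems, of "take m"] by simp
  with Suc show ?case
    by (simp add: discards_def packs_def)
qed simp

lemma content_subset: "content A \<delta> es xs m \<subseteq> {..<m}"
  by (induction m) (auto simp: less_Suc_eq)

lemma finite_content: "finite (content A \<delta> es xs m)"
  by (rule finite_subset[OF content_subset]) simp

text \<open>An item can enter only in the step that reveals it, so absence after that step is
  permanent.\<close>

lemma content_later:
  assumes "i \<in> content A \<delta> es xs n" "i < m" "m \<le> n"
  shows "i \<in> content A \<delta> es xs m"
  using assms(3,1)
proof (induction n rule: dec_induct)
  case (step n)
  with assms(2) show ?case by (simp split: if_splits)
qed

lemma total_size_mono:
  assumes "finite T" "S \<subseteq> T" "\<And>i. i \<in> T \<Longrightarrow> 0 \<le> xs ! i"
  shows "total_size xs S \<le> total_size xs T"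
  unfolding total_size_def using assms by (intro sum_mono2) auto

lemma total_size_content_le_1:
  assumes "online_algorithm \<delta> A" "knapsack_instance \<delta> es xs" "m \<le> length xs"
  shows "total_size xs (content A \<delta> es xs m) \<le> 1"
  using assms(3)
proof (induction m)
  case 0
  then show ?case by (simp add: total_size_def)
next
  case (Suc m)
  let ?C = "content A \<delta> es xs m" and ?D = "discards A \<delta> es xs m"
  have fin: "finite (?C - ?D)" and notin: "m \<notin> ?C - ?D"
    using finite_content content_subset[of A \<delta> es xs m] by auto
  show ?case
  proof (cases "packs A \<delta> es xs m")
    case True
    with assms Suc.prems have "total_size xs (?C - ?D) + xs ! m \<le> 1"
      unfolding online_algorithm_def by auto
    with True fin notin show ?thesis
      by (simp add: total_size_def)
  next
    case False
    have "total_size xs (?C - ?D) \<le> total_size xs ?C"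
    proof (rule total_size_mono)
      fix i assume "i \<in> ?C"
      then show "0 \<le> xs ! i"
        using assms(2) Suc.prems content_subset[of A \<delta> es xs m]
        by (auto simp: knapsack_instance_def)
    qed (auto simp: finite_content)
    with False Suc show ?thesis by simp
  qed
qed

lemma content_pair_fits:
  assumes "online_algorithm \<delta> A" "knapsack_instance \<delta> es xs" "m \<le> length xs"
    and "i \<in> content A \<delta> es xs m" "j \<in> content A \<delta> es xs m" "i \<noteq> j"
  shows "xs ! i + xs ! j \<le> 1"
proof -
  have "total_size xs {i, j} \<le> total_size xs (content A \<delta> es xs m)"
  proof (rule total_size_mono)
    fix k assume "k \<in> content A \<delta> es xs m"
    then show "0 \<le> xs ! k"
      using assms(2,3) content_subset[of A \<delta> es xs m] by (auto simp: knapsack_instance_def)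
  qed (use assms(4,5) finite_content in auto)
  with total_size_content_le_1[OF assms(1-3)] assms(6) show ?thesis
    by (simp add: total_size_def)
qed

text \<open>A feasible final content inside \<open>S\<close> holds at most one item. The assumption
  \<open>0 \<le> B\<close> covers the empty content.\<close>

lemma gain_le_if_pairwise_unfit:
  assumes "online_algorithm \<delta> A" "knapsack_instance \<delta> es xs"
    and "content A \<delta> es xs (length xs) \<subseteq> S"
    and "\<And>i j. i \<in> S \<Longrightarrow> j \<in> S \<Longrightarrow> i < j \<Longrightarrow> xs ! i + xs ! j > 1"
    and "\<And>i. i \<in> S \<Longrightarrow> xs ! i \<le> B" "0 \<le> B"
  shows "gain A \<delta> es xs \<le> B"
proof -
  let ?C = "content A \<delta> es xs (length xs)"
  have same: "i = j" if "i \<in> ?C" "j \<in> ?C" for i j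
  proof (rule ccontr)
    assume "i \<noteq> j"
    then have "xs ! i + xs ! j \<le> 1"
      by (rule content_pair_fits[OF assms(1,2) order_refl that])
    with assms(4)[of i j] assms(4)[of j i] assms(3) that \<open>i \<noteq> j\<close> show False
      by (cases i j rule: linorder_cases) auto
  qed
  consider "?C = {}" | k where "?C = {k}"
    using same by blast
  then show ?thesis
    using assms(3,5,6) by cases (auto simp: gain_def total_size_def)
qed

lemma gain_nonneg:
  assumes "knapsack_instance \<delta> es xs"
  shows "0 \<le> gain A \<delta> es xs"
  unfolding gain_def total_size_def
  using assms content_subset[of A \<delta> es xs "length xs"]
  by (intro sum_nonneg) (auto simp: knapsack_instance_def)

lemma total_size_le_OPT:
  assumes "S \<subseteq> {..<length xs}" "total_size xs S \<le> 1"
  shows "total_size xs S \<le> OPT xs"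
proof -
  have "{total_size xs S | S. S \<subseteq> {..<length xs} \<and> total_size xs S \<le> 1}
      \<subseteq> total_size xs ` Pow {..<length xs}"
    by blast
  then have "finite {total_size xs S | S. S \<subseteq> {..<length xs} \<and> total_size xs S \<le> 1}"
    by (rule finite_subset) simp
  then show ?thesis
    unfolding OPT_def by (rule Max_ge) (use assms in blast)
qed

text \<open>A gain of 0 against a positive optimum would make the ratio infinite, so the gain is
  positive and the division takes place in the reals.\<close>

lemma OPT_less_mult_gain:
  assumes "knapsack_instance \<delta> es xs" "competitive_ratio \<delta> A < ennreal c" "0 < OPT xs"
  shows "OPT xs < c * gain A \<delta> es xs"
proof -
  let ?g = "gain A \<delta> es xs"
  have "ennreal (OPT xs) / ennreal ?g \<le> competitive_ratio \<delta> A"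
    unfolding competitive_ratio_def using assms(1)
    by (intro SUP_upper2[of "(es, xs)"]) auto
  with assms(2) have less: "ennreal (OPT xs) / ennreal ?g < ennreal c"
    by (rule le_less_trans[rotated])
  have "?g \<noteq> 0"
    using less assms(3) by (auto simp: ennreal_divide_zero)
  with gain_nonneg[OF assms(1)] have "0 < ?g"
    by (simp add: less_le)
  with less assms(3) show ?thesis
    by (simp add: divide_ennreal ennreal_less_iff field_simps)
qed

text \<open>The form used against the algorithm: one feasible packing \<open>S\<close> bounds the
  optimum from below, without computing it.\<close>

lemma OPT_bound_less_mult_gain_bound:
  assumes "knapsack_instance \<delta> es xs" "competitive_ratio \<delta> A < ennreal c" "0 < c"
    and "S \<subseteq> {..<length xs}" "total_size xs S = v" "0 < v" "v \<le> 1"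
    and "gain A \<delta> es xs \<le> g"
  shows "v < c * g"
proof -
  have v: "v \<le> OPT xs"
    using total_size_le_OPT[of S xs] assms by simp
  with OPT_less_mult_gain[OF assms(1,2)] assms(6) have "v < c * gain A \<delta> es xs"
    by simp
  also have "\<dots> \<le> c * g"
    using assms(3,8) by simp
  finally show ?thesis .
qed

text \<open>Every deviation from one forced line of play is refuted by \<open>c * x < 1\<close>; the
  inequality compares optimum and gain on that line. The assumption
  \<open>2 * \<delta> \<le> s\<close> keeps the smallest last item nonnegative.\<close>

lemma adversary:
  fixes \<delta> s x \<eta> c :: real
  assumes alg: "online_algorithm \<delta> A" and cr: "competitive_ratio \<delta> A < ennreal c"
    and s: "s = 1 - x" "2 * \<delta> \<le> s" "x \<le> 1" "3 / 5 \<le> x" "\<delta> \<le> 1 / 5"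
    and \<eta>: "0 < \<eta>" "10 * \<eta> \<le> \<delta>" and c: "0 < c" "c * x < 1"
  shows "1 - 2 * \<delta> + 2 * \<eta> < c * (2 * s - 2 * \<delta> + 5 * \<eta>)"
proof -
  \<comment> \<open>The multiples of \<open>\<eta>\<close> make each intended pair sum to exactly 1
    and each forbidden pair exceed 1. Only the last estimate is offset by \<open>\<delta>\<close>,
    so that its size can range from about \<open>s - 2 * \<delta>\<close> to
    \<open>s\<close>.\<close>
  define es where "es = [s + 2 * \<eta>, x - \<eta>, x, s + 3 * \<eta> - \<delta>]"
  define xs where "xs z y = [s + 2 * \<eta>, x - \<eta>, z, y]" for z y
  let ?C = "\<lambda>z y m. content A \<delta> es (xs z y) m"
  have inst: "knapsack_instance \<delta> es (xs z y)"
    if "x - 2 * \<eta> \<le> z" "z \<le> x" "s + 3 * \<eta> - 2 * \<delta> \<le> y" "y \<le> s + 3 * \<eta>" for z y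
    unfolding knapsack_instance_def es_def xs_def using that s \<eta>
    by (simp add: All_less_Suc2 numeral_eq_Suc)
  have len [simp]: "length (xs z y) = 4" for z y
    by (simp add: xs_def)
  have nth [simp]: "xs z y ! 0 = s + 2 * \<eta>" "xs z y ! Suc 0 = x - \<eta>" "xs z y ! 2 = z" "xs z y ! 3 = y"
    for z y by (simp_all add: xs_def)
  have C4: "?C z y 4 \<subseteq> {0, 1, 2, 3}" for z y
    using content_subset[of A \<delta> es "xs z y" 4] by auto
  have C2: "?C z y 2 = ?C z' y' 2" for z y z' y'
    by (rule content_cong_take) (simp add: xs_def)
  have C3: "?C z y 3 = ?C z y' 3" for z y y'
    by (rule content_cong_take) (simp add: xs_def)
  have lost: "i \<notin> ?C z y 4" if "i \<notin> ?C z y m" "i < m" "m \<le> 4" for i z y m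
    using content_later that by blast
  \<comment> \<open>Optimum 1 against gain at most \<open>x\<close> would force
    \<open>1 < c * x\<close>.\<close>
  have beaten: False
    if i: "knapsack_instance \<delta> es (xs z y)" and C: "?C z y 4 \<subseteq> S"
      and unfit: "\<And>i j. i \<in> S \<Longrightarrow> j \<in> S \<Longrightarrow> i < j \<Longrightarrow> xs z y ! i + xs z y ! j > 1"
      and le: "\<And>i. i \<in> S \<Longrightarrow> xs z y ! i \<le> x"
      and T: "T \<subseteq> {..<4}" "total_size (xs z y) T = 1"
    for z y S T
  proof -
    have "gain A \<delta> es (xs z y) \<le> x"
      using gain_le_if_pairwise_unfit[OF alg i _ unfit le] C s by simp
    from OPT_bound_less_mult_gain_bound[OF i cr c(1) _ T(2) _ _ this] T(1) c(2)
    show False by simp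
  qed
  have held_first: "0 \<in> ?C z y 2" for z y
  proof (rule ccontr)
    assume "0 \<notin> ?C z y 2"
    \<comment> \<open>This \<open>?z\<close> completes item 0 to exactly 1, while \<open>?y\<close>
      overfills with item 1 or item 2. Items 1 and 2 clash because \<open>x\<close> is at least
      3/5.\<close>
    let ?z = "x - 2 * \<eta>" and ?y = "s + 3 * \<eta>"
    have "0 \<notin> ?C ?z ?y 4"
      using \<open>0 \<notin> ?C z y 2\<close> C2[of z y] by (intro lost[of _ _ _ 2]) auto
    with C4 have "?C ?z ?y 4 \<subseteq> {1, 2, 3}"
      by blast
    moreover have "knapsack_instance \<delta> es (xs ?z ?y)"
      using s \<eta> by (intro inst) auto
    moreover have "total_size (xs ?z ?y) {0, 2} = 1"
      using s by (simp add: total_size_def)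
    ultimately show False
      using s \<eta> by (intro beaten[of ?z ?y "{1, 2, 3}" "{0, 2}"]) auto
  qed
  have lost_second: "1 \<notin> ?C z y 2" for z y
  proof
    assume "1 \<in> ?C z y 2"
    \<comment> \<open>Any admissible last two sizes would do: the clash is between items 0 and 1,
      which sum to \<open>1 + \<eta>\<close>.\<close>
    then have "1 \<in> ?C x s 2"
      using C2 by blast
    moreover have "knapsack_instance \<delta> es (xs x s)"
      using s \<eta> by (intro inst) auto
    ultimately show False
      using content_pair_fits[OF alg, of es "xs x s" 2 0 1] held_first s \<eta> by simp
  qed
  have held_first': "0 \<in> ?C x y 3" for y
  proof (rule ccontr)
    assume "0 \<notin> ?C x y 3"
    \<comment> \<open>Exactly the complement of item 1, and too large by \<open>\<eta>\<close> for
      item 2.\<close>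
    let ?y = "s + \<eta>"
    have "0 \<notin> ?C x ?y 4"
      using \<open>0 \<notin> ?C x y 3\<close> C3[of x y] by (intro lost[of _ _ _ 3]) auto
    moreover have "1 \<notin> ?C x ?y 4"
      using lost_second by (intro lost[of _ _ _ 2]) auto
    ultimately have "?C x ?y 4 \<subseteq> {2, 3}"
      using C4 by blast
    moreover have "knapsack_instance \<delta> es (xs x ?y)"
      using s \<eta> by (intro inst) auto
    moreover have "total_size (xs x ?y) {1, 3} = 1"
      using s by (simp add: total_size_def)
    ultimately show False
      using s \<eta> by (intro beaten[of x ?y "{2, 3}" "{1, 3}"]) auto
  qed
  \<comment> \<open>The least size the estimate allows. Item 0 is still held and excludes item 2, so
    at best items 0 and 3 remain, whereas \<open>{1, 3}\<close> is feasible.\<close>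
  let ?y = "s + 3 * \<eta> - 2 * \<delta>"
  have i: "knapsack_instance \<delta> es (xs x ?y)"
    using s \<eta> by (intro inst) auto
  have "2 \<notin> ?C x ?y 3"
    using content_pair_fits[OF alg i, of 3 0 2] held_first' s \<eta> by auto
  then have "2 \<notin> ?C x ?y 4"
    by (intro lost[of _ _ _ 3]) auto
  moreover have "1 \<notin> ?C x ?y 4"
    using lost_second by (intro lost[of _ _ _ 2]) auto
  ultimately have "?C x ?y 4 \<subseteq> {0, 3}"
    using C4 by blast
  then have "gain A \<delta> es (xs x ?y) \<le> total_size (xs x ?y) {0, 3}"
    unfolding gain_def len using s \<eta> by (intro total_size_mono) auto
  then have "gain A \<delta> es (xs x ?y) \<le> 2 * s - 2 * \<delta> + 5 * \<eta>"
    by (simp add: total_size_def)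
  then show ?thesis
    using s \<eta>
    by (intro OPT_bound_less_mult_gain_bound[OF i cr c(1), of "{1, 3}"])
       (auto simp: total_size_def)
qed

theorem theorem16:
  fixes \<delta> x :: real
  assumes "\<delta> \<in> {0<..3 / 4 - sqrt 5 / 4}"
    and "x = (2 - 2 * \<delta>) / (3 - 2 * \<delta>)"
  shows "\<not> (\<exists>A. online_algorithm \<delta> A \<and> competitive_ratio \<delta> A < ennreal (1 / x))"
proof
  assume "\<exists>A. online_algorithm \<delta> A \<and> competitive_ratio \<delta> A < ennreal (1 / x)"
  then obtain A where alg: "online_algorithm \<delta> A"
    and cr: "competitive_ratio \<delta> A < ennreal (1 / x)"
    by blast
  \<comment> \<open>A rational lower bound for \<open>sqrt 5\<close> that yields
    \<open>\<delta> \<le> 1 / 5\<close>.\<close>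
  have "(11 / 5)\<^sup>2 \<le> (5 :: real)"
    by (simp add: power2_eq_square)
  then have "11 / 5 \<le> sqrt 5"
    by (rule real_le_rsqrt)
  with assms(1) have \<delta>: "0 < \<delta>" "\<delta> \<le> 1 / 5" "sqrt 5 \<le> 3 - 4 * \<delta>"
    by auto
  \<comment> \<open>The upper bound on \<open>\<delta>\<close> is the smaller root of the quadratic
    in \<open>quad\<close>, which is \<open>2 * \<delta> \<le> 1 - x\<close> with the denominator
    cleared.\<close>
  have "(sqrt 5)\<^sup>2 \<le> (3 - 4 * \<delta>)\<^sup>2"
    using \<delta> by (intro power_mono) auto
  then have quad: "0 \<le> 1 - 6 * \<delta> + 4 * \<delta>\<^sup>2"
    by (simp add: power2_eq_square algebra_simps)
  have x: "x * (3 - 2 * \<delta>) = 2 - 2 * \<delta>" "x \<le> 1" "3 / 5 \<le> x"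
    unfolding assms(2) using \<delta> by (simp_all add: divide_le_eq le_divide_eq)
  have "2 * \<delta> \<le> 1 - x"
    unfolding assms(2) using \<delta> quad by (simp add: field_simps power2_eq_square)
  \<comment> \<open>A value strictly between the ratio and \<open>1 / x\<close> leaves the slack
    \<open>1 - c * x\<close> to absorb the perturbation.\<close>
  obtain t where t: "competitive_ratio \<delta> A < t" "t < ennreal (1 / x)"
    using dense[OF cr] by blast
  then obtain c where c: "t = ennreal c" "0 \<le> c"
    by (cases t) auto
  have "0 < c"
    using t(1) c by (cases "c = 0") auto
  have cx: "c * x < 1"
    using t(2) c x by (simp add: ennreal_less_iff field_simps)
  \<comment> \<open>The second term bounds the perturbation cost \<open>5 * c * \<eta>\<close> by
    the slack, scaled by \<open>1 - 2 * \<delta>\<close>.\<close>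
  define \<eta> where "\<eta> = min (\<delta> / 10) ((1 - 2 * \<delta>) * (1 - c * x) / (5 * c))"
  have \<eta>: "0 < \<eta>" "10 * \<eta> \<le> \<delta>"
    using \<delta> \<open>0 < c\<close> cx by (auto simp: \<eta>_def)
  have "\<eta> \<le> (1 - 2 * \<delta>) * (1 - c * x) / (5 * c)"
    by (simp add: \<eta>_def)
  then have "5 * c * \<eta> \<le> (1 - 2 * \<delta>) * (1 - c * x)"
    using \<open>0 < c\<close> by (simp add: field_simps)
  moreover have "2 * (1 - x) - 2 * \<delta> = x * (1 - 2 * \<delta>)"
    using x(1) by (simp add: algebra_simps)
  then have "c * (2 * (1 - x) - 2 * \<delta> + 5 * \<eta>) = c * x * (1 - 2 * \<delta>) + 5 * c * \<eta>"
    by (simp add: distrib_left)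
  ultimately have "c * (2 * (1 - x) - 2 * \<delta> + 5 * \<eta>) \<le> 1 - 2 * \<delta>"
    by (simp add: algebra_simps)
  moreover have "1 - 2 * \<delta> + 2 * \<eta> < c * (2 * (1 - x) - 2 * \<delta> + 5 * \<eta>)"
    using adversary[OF alg t(1)[unfolded c(1)] refl] \<open>2 * \<delta> \<le> 1 - x\<close> x \<delta> \<eta> \<open>0 < c\<close> cx
    by blast
  ultimately show False
    using \<eta> by simp
qed

end
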